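(* There is an algorithm which, given integers $n\ge1$, $d\ge1$, $M\in\mathbb N$, the zeros $\tau_1,\dots,\tau_n$ of the Legendre polynomial $P_n$, control points $W_0,\dots,W_n\in\mathbb E^d$, and parameters $-1\le t_0<t_1<\cdots<t_M\le1$, computes all the points $$\mathsf P_n(t_0),\mathsf P_n(t_1),\dots,\mathsf P_n(t_M)$$ of the Gauss--Legendre curve $\mathsf P_n(t)=\sum_{i=0}^nW_iF^n_i(t)$ of degree $n$ with computational complexity $O(Mdn+dn^2)$.
   Context: Computational complexity means the number of real arithmetic operations, with implied constant independent of $n,d,M$, the control points and the parameters; the zeros of $P_n$ are assumed to be known (precomputed). $\mathbb E^d$ is $d$-dimensional Euclidean space. $P_k$ is the $k$th Legendre polynomial, $P_k(1)=1$, and $-1<\tau_1<\cdots<\tau_n<1$ are the zeros of $P_n$. Gauss--Legendre polynomials: set $G^n_0(t)\equiv\frac12$, $G^n_{n+1}(t)\equiv-\frac12$, and for $i=1,\dots,n$ $$G^n_i(t):=\frac{nP_{n-1}(\tau_i)}{2}\int_{-1}^{t}\frac{P_n(x)}{x-\tau_i}\,dx-\frac12 ,$$ where $P_n(x)/(x-\tau_i)$ is regarded as a polynomial. Then $F^n_i(t):=G^n_i(t)-G^n_{i+1}(t)$ for $i=0,1,\dots,n$. *)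

theory Defs
  imports "HOL-Analysis.Analysis" "HOL-Computational_Algebra.Polynomial"
begin

text \<open>Legendre polynomials, by Rodrigues' formula (so that the value at 1 is 1).\<close>

definition legendre :: "nat \<Rightarrow> real poly" where
  "legendre k = smult (1 / (2 ^ k * fact k)) ((pderiv ^^ k) ([:-1, 0, 1:] ^ k))"

definition legendre_zeros :: "nat \<Rightarrow> (nat \<Rightarrow> real) \<Rightarrow> bool" where
  "legendre_zeros n \<tau> \<longleftrightarrow>
     strict_mono_on {1..n} \<tau> \<and> (\<forall>i\<in>{1..n}. -1 < \<tau> i \<and> \<tau> i < 1) \<and>
     {x. poly (legendre n) x = 0} = \<tau> ` {1..n}"

text \<open>In \<open>GL_G\<close> the division by \<open>[:- \<tau> i, 1:]\<close> is exact when \<open>\<tau> i\<close> is a zero of the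
  Legendre polynomial. The integral is the intended one for \<open>t \<ge> -1\<close> only; the curve is
  only evaluated on \<open>{-1..1}\<close>.\<close>

definition GL_G :: "nat \<Rightarrow> (nat \<Rightarrow> real) \<Rightarrow> nat \<Rightarrow> real \<Rightarrow> real" where
  "GL_G n \<tau> i t =
     (if i = 0 then 1 / 2
      else if i = n + 1 then - 1 / 2
      else real n * poly (legendre (n - 1)) (\<tau> i) / 2 *
             integral {-1..t} (\<lambda>x. poly (legendre n div [:- \<tau> i, 1:]) x) - 1 / 2)"

definition GL_F :: "nat \<Rightarrow> (nat \<Rightarrow> real) \<Rightarrow> nat \<Rightarrow> real \<Rightarrow> real" where
  "GL_F n \<tau> i t = GL_G n \<tau> i t - GL_G n \<tau> (i + 1) t"

text \<open>The dimension \<open>d\<close> is a run-time input of the algorithm, so a point of Euclidean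
  \<open>d\<close>-space is given by its coordinates \<open>0, \<dots>, d - 1\<close>; coordinates from \<open>d\<close> on are
  irrelevant.\<close>

type_synonym point = "nat \<Rightarrow> real"

definition GL_curve :: "nat \<Rightarrow> (nat \<Rightarrow> real) \<Rightarrow> (nat \<Rightarrow> point) \<Rightarrow> real \<Rightarrow> point" where
  "GL_curve n \<tau> W t = (\<lambda>c. \<Sum>i = 0..n. W i c * GL_F n \<tau> i t)"

text \<open>The model of computation is a real RAM, programmed in a while language. Index registers
  hold natural numbers and are used for control flow and for addressing arrays of real numbers.
  There is no conversion from indices to real numbers, and the only real constants of a
  program are integers, so all other real values have to be obtained by counted arithmetic.\<close>

record ram =
  reg :: "string \<Rightarrow> nat"
  arr :: "string \<Rightarrow> nat \<Rightarrow> real"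

datatype iexp =
    INat nat
  | IReg string
  | IAdd iexp iexp
  | ISub iexp iexp
  | IMul iexp iexp

fun ival :: "iexp \<Rightarrow> ram \<Rightarrow> nat" where
  "ival (INat k) s = k"
| "ival (IReg x) s = reg s x"
| "ival (IAdd a b) s = ival a s + ival b s"
| "ival (ISub a b) s = ival a s - ival b s"
| "ival (IMul a b) s = ival a s * ival b s"

datatype cell = Cell string iexp

fun load :: "cell \<Rightarrow> ram \<Rightarrow> real" where
  "load (Cell a e) s = arr s a (ival e s)"

fun store :: "cell \<Rightarrow> real \<Rightarrow> ram \<Rightarrow> ram" where
  "store (Cell a e) x s = s\<lparr>arr := (arr s)(a := (arr s a)(ival e s := x))\<rparr>"

datatype rop = RAdd | RSub | RMul | RDiv

fun rop_fun :: "rop \<Rightarrow> real \<Rightarrow> real \<Rightarrow> real" where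
  "rop_fun RAdd x y = x + y"
| "rop_fun RSub x y = x - y"
| "rop_fun RMul x y = x * y"
| "rop_fun RDiv x y = x / y"

datatype test = IndexLess iexp iexp | RealLess cell cell

fun test_val :: "test \<Rightarrow> ram \<Rightarrow> bool" where
  "test_val (IndexLess a b) s \<longleftrightarrow> ival a s < ival b s"
| "test_val (RealLess p q) s \<longleftrightarrow> load p s < load q s"

fun test_cost :: "test \<Rightarrow> nat" where
  "test_cost (IndexLess a b) = 0"
| "test_cost (RealLess p q) = 1"

datatype prog =
    Skip
  | SetReg string iexp
  | SetConst cell int
  | Copy cell cell
  | Arith rop cell cell cell
  | Seq prog prog
  | Cond test prog prog
  | Loop test prog

text \<open>\<open>exec p s k s'\<close>: started in state \<open>s\<close>, the program \<open>p\<close> terminates in state \<open>s'\<close> after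
  performing exactly \<open>k\<close> real operations (additions, subtractions, multiplications, divisions
  and comparisons). A program that divides by zero gets stuck.\<close>

inductive exec :: "prog \<Rightarrow> ram \<Rightarrow> nat \<Rightarrow> ram \<Rightarrow> bool" where
  Skip: "exec Skip s 0 s"
| SetReg: "exec (SetReg x e) s 0 (s\<lparr>reg := (reg s)(x := ival e s)\<rparr>)"
| SetConst: "exec (SetConst p z) s 0 (store p (of_int z) s)"
| Copy: "exec (Copy p q) s 0 (store p (load q s) s)"
| Arith: "(f = RDiv \<Longrightarrow> load r s \<noteq> 0) \<Longrightarrow>
    exec (Arith f p q r) s 1 (store p (rop_fun f (load q s) (load r s)) s)"
| Seq: "exec c1 s k1 s1 \<Longrightarrow> exec c2 s1 k2 s2 \<Longrightarrow> exec (Seq c1 c2) s (k1 + k2) s2"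
| CondTrue: "test_val b s \<Longrightarrow> exec c1 s k s' \<Longrightarrow>
    exec (Cond b c1 c2) s (test_cost b + k) s'"
| CondFalse: "\<not> test_val b s \<Longrightarrow> exec c2 s k s' \<Longrightarrow>
    exec (Cond b c1 c2) s (test_cost b + k) s'"
| LoopFalse: "\<not> test_val b s \<Longrightarrow> exec (Loop b c) s (test_cost b) s"
| LoopTrue: "test_val b s \<Longrightarrow> exec c s k1 s1 \<Longrightarrow> exec (Loop b c) s1 k2 s2 \<Longrightarrow>
    exec (Loop b c) s (test_cost b + k1 + k2) s2"

inductive_cases exec_cases:
  "exec Skip s k s'" "exec (SetReg x e) s k s'" "exec (SetConst p z) s k s'"
  "exec (Copy p q) s k s'" "exec (Arith f p q r) s k s'" "exec (Seq c1 c2) s k s'"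
  "exec (Cond b c1 c2) s k s'" "exec (Loop b c) s k s'"

text \<open>Result and operation count are determined by program and initial state.\<close>

lemma exec_deterministic:
  "exec c s k s' \<Longrightarrow> exec c s l u \<Longrightarrow> k = l \<and> s' = u"
proof (induction arbitrary: l u rule: exec.induct)
  case (Seq c1 s k1 s1 c2 k2 s2)
  from Seq.prems show ?case
    by (rule exec_cases(6)) (use Seq.IH in blast)
next
  case (CondTrue b s c1 k s' c2)
  from CondTrue.prems show ?case
    by (rule exec_cases(7)) (use CondTrue.hyps CondTrue.IH in blast)+
next
  case (CondFalse b s c2 k s' c1)
  from CondFalse.prems show ?case
    by (rule exec_cases(7)) (use CondFalse.hyps CondFalse.IH in blast)+
next
  case (LoopFalse b s c)
  from LoopFalse.prems show ?case
    by (rule exec_cases(8)) (use LoopFalse.hyps in blast)+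
next
  case (LoopTrue b s c k1 s1 k2 s2)
  from LoopTrue.prems show ?case
    by (rule exec_cases(8)) (use LoopTrue.hyps LoopTrue.IH in blast)+
qed (auto elim: exec_cases)

text \<open>Input and output conventions. Points are stored row by row, \<open>d\<close> cells each. The
  contents of all other registers and cells are arbitrary.\<close>

definition has_input ::
  "ram \<Rightarrow> nat \<Rightarrow> nat \<Rightarrow> nat \<Rightarrow> (nat \<Rightarrow> real) \<Rightarrow> (nat \<Rightarrow> point) \<Rightarrow> (nat \<Rightarrow> real) \<Rightarrow> bool" where
  "has_input s n d M \<tau> W t \<longleftrightarrow>
     reg s ''n'' = n \<and> reg s ''d'' = d \<and> reg s ''M'' = M \<and>
     (\<forall>i\<in>{1..n}. arr s ''tau'' i = \<tau> i) \<and>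
     (\<forall>i\<le>n. \<forall>c<d. arr s ''W'' (i * d + c) = W i c) \<and>
     (\<forall>j\<le>M. arr s ''t'' j = t j)"

definition has_output :: "ram \<Rightarrow> nat \<Rightarrow> nat \<Rightarrow> (nat \<Rightarrow> point) \<Rightarrow> bool" where
  "has_output s d M Q \<longleftrightarrow> (\<forall>j\<le>M. \<forall>c<d. arr s ''out'' (j * d + c) = Q j c)"

end

theory Submission
  imports Defs
begin

text \<open>
  The idea is to convert the curve to the monomial basis once, at a cost of \<open>O(d n\<^sup>2)\<close>, and then to
  evaluate each coordinate at each parameter by Horner's rule, at a cost of \<open>O(n)\<close>.

  Summation by parts turns \<open>\<Sum>i. W i * (G i - G (i + 1))\<close> into
  \<open>W 0 + (\<Sum>i<n. (W (i + 1) - W i) * (G (i + 1) + 1/2))\<close>. Up to the constant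
  \<open>g i = n * P\<^bsub>n-1\<^esub>(\<tau> i) / 2\<close>, the function \<open>G i + 1/2\<close> is the integral from \<open>-1\<close> of the quotient of
  \<open>P\<^sub>n\<close> by \<open>x - \<tau> i\<close>. Hence every coordinate of the curve is \<open>W 0 + A t - A (-1)\<close>, where \<open>A\<close> is an
  antiderivative of a polynomial of degree less than \<open>n\<close> (\<open>GL_curve_eq\<close>). The coefficients of that
  polynomial are a sum of \<open>n\<close> quotients, each of which synthetic division yields in \<open>O(n)\<close>
  operations; so a coordinate costs \<open>O(n\<^sup>2)\<close> before the first evaluation.

  The coefficients of \<open>P\<^sub>n\<close> and \<open>P\<^bsub>n-1\<^esub>\<close> are obtained by executing Rodrigues' formula literally:
  \<open>n\<close> multiplications by \<open>(x\<^sup>2 - 1) / (2 i)\<close> and \<open>n\<close> differentiations, each of cost \<open>O(n)\<close>. This stays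
  within the budget.

  Programs are verified with a total-correctness judgement that bounds the operation count
  (\<open>runs\<close>). What a program leaves unchanged is read off its syntax (\<open>exec_frame\<close>), so that the
  invariants in the loop rule \<open>runs_For\<close> only speak of the arrays being written.
\<close>

section \<open>Reasoning about programs\<close>

definition runs :: "prog \<Rightarrow> ram \<Rightarrow> nat \<Rightarrow> (ram \<Rightarrow> bool) \<Rightarrow> bool" where
  "runs c s K Q \<longleftrightarrow> (\<exists>k s'. exec c s k s' \<and> k \<le> K \<and> Q s')"

fun iregs :: "iexp \<Rightarrow> string set" where
  "iregs (INat k) = {}"
| "iregs (IReg x) = {x}"
| "iregs (IAdd a b) = iregs a \<union> iregs b"
| "iregs (ISub a b) = iregs a \<union> iregs b"
| "iregs (IMul a b) = iregs a \<union> iregs b"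

fun cell_arr :: "cell \<Rightarrow> string" where
  "cell_arr (Cell a e) = a"

fun wregs :: "prog \<Rightarrow> string set" where
  "wregs (SetReg x e) = {x}"
| "wregs (Seq c1 c2) = wregs c1 \<union> wregs c2"
| "wregs (Cond b c1 c2) = wregs c1 \<union> wregs c2"
| "wregs (Loop b c) = wregs c"
| "wregs _ = {}"

fun warrs :: "prog \<Rightarrow> string set" where
  "warrs (SetConst p z) = {cell_arr p}"
| "warrs (Copy p q) = {cell_arr p}"
| "warrs (Arith f p q r) = {cell_arr p}"
| "warrs (Seq c1 c2) = warrs c1 \<union> warrs c2"
| "warrs (Cond b c1 c2) = warrs c1 \<union> warrs c2"
| "warrs (Loop b c) = warrs c"
| "warrs _ = {}"

text \<open>The frame condition is syntactic and by array name: an array that the program never mentions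
  as a target is preserved as a whole, so no reasoning about addresses is needed for it.\<close>

definition frame :: "prog \<Rightarrow> ram \<Rightarrow> ram \<Rightarrow> bool" where
  "frame c s s' \<longleftrightarrow>
     (\<forall>x. x \<notin> wregs c \<longrightarrow> reg s' x = reg s x) \<and> (\<forall>a. a \<notin> warrs c \<longrightarrow> arr s' a = arr s a)"

lemma ival_cong: "(\<And>x. x \<in> iregs e \<Longrightarrow> reg s x = reg s' x) \<Longrightarrow> ival e s = ival e s'"
  by (induction e) auto

lemma reg_store [simp]: "reg (store p x s) = reg s"
  by (cases p) auto

lemma arr_store: "a \<noteq> cell_arr p \<Longrightarrow> arr (store p x s) a = arr s a"
  by (cases p) auto

lemma ival_store [simp]: "ival e (store p x s) = ival e s"
  by (rule ival_cong) simp

lemma exec_frame: "exec c s k s' \<Longrightarrow> frame c s s'"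
  unfolding frame_def by (induction rule: exec.induct) (auto simp: arr_store)

lemma ival_frame: "frame c s s' \<Longrightarrow> iregs e \<inter> wregs c = {} \<Longrightarrow> ival e s' = ival e s"
  by (rule ival_cong) (auto simp: frame_def)

lemma runs_mono:
  "runs c s K Q \<Longrightarrow> K \<le> K' \<Longrightarrow> (\<And>s'. Q s' \<Longrightarrow> frame c s s' \<Longrightarrow> Q' s') \<Longrightarrow> runs c s K' Q'"
  unfolding runs_def using exec_frame by (meson order_trans)

lemma runs_Seq:
  assumes "runs c1 s K1 Q1" and "\<And>s1. Q1 s1 \<Longrightarrow> frame c1 s s1 \<Longrightarrow> runs c2 s1 K2 Q"
  shows "runs (Seq c1 c2) s (K1 + K2) Q"
proof -
  from assms(1) obtain k1 s1 where 1: "exec c1 s k1 s1" "k1 \<le> K1" "Q1 s1"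
    unfolding runs_def by blast
  with assms(2) exec_frame obtain k2 s2 where "exec c2 s1 k2 s2" "k2 \<le> K2" "Q s2"
    unfolding runs_def by meson
  with 1 exec.Seq show ?thesis
    unfolding runs_def by (meson add_mono)
qed

lemma runs_SetConst: "runs (SetConst p z) s K Q \<longleftrightarrow> Q (store p (of_int z) s)"
  unfolding runs_def by (auto elim: exec_cases intro: exec.intros)

lemma runs_Copy: "runs (Copy p q) s K Q \<longleftrightarrow> Q (store p (load q s) s)"
  unfolding runs_def by (auto elim: exec_cases intro: exec.intros)

text \<open>For straight-line code the budget is a given number from which each operation subtracts its
  cost. Backward application of these rules reduces such code to a statement about the final
  state, which the simplifier evaluates.\<close>

lemma runs_Arith:
  assumes "f = RDiv \<Longrightarrow> load r s \<noteq> 0" "1 \<le> K"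
    and "Q (store p (rop_fun f (load q s) (load r s)) s)"
  shows "runs (Arith f p q r) s K Q"
  unfolding runs_def using exec.Arith[of f r s p q] assms by blast

lemma runs_Seq_SetConst:
  assumes "runs c (store p (of_int z) s) K Q"
  shows "runs (Seq (SetConst p z) c) s K Q"
  using runs_Seq[of "SetConst p z" s 0 "\<lambda>s'. s' = store p (of_int z) s" c K Q] assms
  by (simp add: runs_SetConst)

lemma runs_Seq_Arith:
  assumes "f = RDiv \<Longrightarrow> load r s \<noteq> 0" "1 \<le> K"
    and "runs c (store p (rop_fun f (load q s) (load r s)) s) (K - 1) Q"
  shows "runs (Seq (Arith f p q r) c) s K Q"
proof -
  have "runs (Seq (Arith f p q r) c) s (1 + (K - 1)) Q"
    by (rule runs_Seq[where ?Q1.0 = "\<lambda>s'. s' = store p (rop_fun f (load q s) (load r s)) s"])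
      (use assms in \<open>auto intro: runs_Arith\<close>)
  then show ?thesis using assms(2) by simp
qed

definition For :: "string \<Rightarrow> iexp \<Rightarrow> prog \<Rightarrow> prog" where
  "For x b c = Seq (SetReg x (INat 0))
     (Loop (IndexLess (IReg x) b) (Seq c (SetReg x (IAdd (IReg x) (INat 1)))))"

lemma wregs_For [simp]: "wregs (For x b c) = insert x (wregs c)"
  and warrs_For [simp]: "warrs (For x b c) = warrs c"
  by (auto simp: For_def)

text \<open>The invariant depends on the arrays only. The registers need no invariant: the counter is
  given, and the others follow from the frame condition relative to the state before the loop,
  which every iteration may use.\<close>

lemma runs_For:
  assumes x: "x \<notin> wregs c" and b: "iregs b \<inter> insert x (wregs c) = {}"
    and N: "ival b s0 = N" and init: "Inv 0 (arr s0)"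
    and step: "\<And>i s. i < N \<Longrightarrow> reg s x = i \<Longrightarrow> frame (For x b c) s0 s \<Longrightarrow> Inv i (arr s) \<Longrightarrow>
      runs c s K (\<lambda>s'. Inv (Suc i) (arr s'))"
  shows "runs (For x b c) s0 (N * K) (\<lambda>s'. Inv N (arr s'))"
proof -
  let ?L = "Loop (IndexLess (IReg x) b) (Seq c (SetReg x (IAdd (IReg x) (INat 1))))"
  have bN: "ival b s = N" if "frame (For x b c) s0 s" for s
    unfolding N[symmetric] using that b by (intro ival_cong) (auto simp: frame_def)
  have loop: "\<exists>k s'. exec ?L s k s' \<and> k \<le> m * K \<and> Inv N (arr s')"
    if "reg s x = i" "m + i = N" "frame (For x b c) s0 s" "Inv i (arr s)" for m i s
    using that
  proof (induction m arbitrary: i s)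
    case 0
    have "exec ?L s (test_cost (IndexLess (IReg x) b)) s"
      by (rule exec.LoopFalse) (use 0 bN in auto)
    with 0 show ?case by (intro exI[of _ 0] exI[of _ s]) auto
  next
    case (Suc m)
    have "i < N" using Suc.prems by simp
    from step[OF this Suc.prems(1,3,4)] obtain k1 s1 where
      1: "exec c s k1 s1" "k1 \<le> K" "Inv (Suc i) (arr s1)"
      unfolding runs_def by blast
    define s2 where "s2 = s1\<lparr>reg := (reg s1)(x := Suc i)\<rparr>"
    have fr: "frame c s s1" by (rule exec_frame) fact
    with x have "reg s1 x = i" using Suc.prems(1) by (simp add: frame_def)
    then have 2: "exec (Seq c (SetReg x (IAdd (IReg x) (INat 1)))) s (k1 + 0) s2"
      using exec.Seq[OF 1(1) exec.SetReg[of x "IAdd (IReg x) (INat 1)"]] by (simp add: s2_def)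
    have "frame (For x b c) s0 s2"
      using fr Suc.prems(3) by (auto simp: frame_def s2_def)
    from Suc.IH[OF _ _ this, of "Suc i"] 1 Suc.prems obtain k2 s3 where
      3: "exec ?L s2 k2 s3" "k2 \<le> m * K" "Inv N (arr s3)"
      by (auto simp: s2_def)
    have "exec ?L s (test_cost (IndexLess (IReg x) b) + (k1 + 0) + k2) s3"
      by (rule exec.LoopTrue[OF _ 2 3(1)]) (use Suc.prems bN in auto)
    moreover have "test_cost (IndexLess (IReg x) b) + (k1 + 0) + k2 \<le> Suc m * K"
      using 1(2) 3(2) by simp
    ultimately show ?case using 3(3) by blast
  qed
  let ?s = "s0\<lparr>reg := (reg s0)(x := 0)\<rparr>"
  have e: "exec (SetReg x (INat 0)) s0 0 ?s"
    using exec.SetReg[of x "INat 0" s0] by simp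
  have "frame (For x b c) s0 ?s"
    by (simp add: frame_def)
  from loop[of ?s 0 N, OF _ _ this] init obtain k s' where
    "exec ?L ?s k s'" "k \<le> N * K" "Inv N (arr s')" by auto
  moreover from this(1) e have "exec (For x b c) s0 (0 + k) s'"
    unfolding For_def by (rule exec.Seq[rotated])
  ultimately show ?thesis
    unfolding runs_def by auto
qed

section \<open>Polynomials by their coefficients\<close>

text \<open>The factor \<open>1 / (2 ^ i * fact i)\<close> is taken inside the derivatives, because a program can
  then build it up together with the power, dividing by \<open>2 * i + 2\<close> in step \<open>i\<close>.\<close>

definition rodrigues :: "nat \<Rightarrow> real poly" where
  "rodrigues i = smult (1 / (2 ^ i * fact i)) ([:-1, 0, 1:] ^ i)"

lemma legendre_rodrigues: "legendre m = (pderiv ^^ m) (rodrigues m)"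
  by (simp add: legendre_def rodrigues_def higher_pderiv_smult)

lemma coeff_rodrigues_0: "coeff (rodrigues 0) k = (if k = 0 then 1 else 0)"
  by (simp add: rodrigues_def one_pCons coeff_pCons split: nat.splits)

lemma coeff_rodrigues_Suc:
  "coeff (rodrigues (Suc i)) k =
     ((if k < 2 then 0 else coeff (rodrigues i) (k - 2)) - coeff (rodrigues i) k) / (2 * real i + 2)"
proof -
  have "rodrigues (Suc i) = smult (1 / (2 * real i + 2)) ([:-1, 0, 1:] * rodrigues i)"
    by (simp add: rodrigues_def field_simps)
  moreover have "coeff ([:-1, 0, 1:] * q) k = (if k < 2 then 0 else coeff q (k - 2)) - coeff q k"
    for q :: "real poly"
    by (auto simp: coeff_pCons split: nat.splits)
  ultimately show ?thesis by simp
qed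

lemma degree_legendre_le: "degree (legendre m) \<le> m"
proof -
  have "degree (rodrigues m) \<le> 2 * m"
    using degree_power_le[of "[:-1, 0, 1::real:]" m] by (simp add: rodrigues_def)
  then show ?thesis
    by (simp add: legendre_rodrigues degree_higher_pderiv)
qed

text \<open>The remainder of synthetic division is a constant, and \<open>div\<close> discards it.\<close>

lemma div_linear_eq_synthetic_div: "p div [:- a, 1:] = synthetic_div p a" for a :: real
proof -
  have "p div [:- a, 1:] = ([:poly p a:] + synthetic_div p a * [:- a, 1:]) div [:- a, 1:]"
    using synthetic_div_correct'[of a p] by (simp only: add.commute mult.commute)
  also have "\<dots> = synthetic_div p a"
    by (subst div_mult_self1) (simp_all add: div_poly_less)
  finally show ?thesis .
qed

text \<open>Horner's recursion, running from the leading coefficient downwards; it lets a program produce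
  the quotient one coefficient at a time.\<close>

lemma coeff_synthetic_div:
  "coeff (synthetic_div p a) k = coeff p (Suc k) + a * coeff (synthetic_div p a) (Suc k)"
  for a :: real
  using arg_cong[OF synthetic_div_correct[of p a], of "\<lambda>q. coeff q (Suc k)"] by simp

lemma poly_eq_sum: "degree p < n \<Longrightarrow> poly p x = (\<Sum>k<n. coeff p k * x ^ k)"
  for p :: "real poly"
  unfolding poly_altdef
  by (rule sum.mono_neutral_left) (auto intro: coeff_eq_0)

lemma integral_poly:
  fixes p :: "real poly"
  assumes "degree p < n" "a \<le> b"
  shows "integral {a..b} (poly p) = 
    (\<Sum>k<n. coeff p k / (real k + 1) * b ^ Suc k) - (\<Sum>k<n. coeff p k / (real k + 1) * a ^ Suc k)"
proof (rule integral_unique, rule fundamental_theorem_of_calculus)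
  fix x assume "x \<in> {a..b}"
  have "((\<lambda>x. \<Sum>k<n. coeff p k / (real k + 1) * x ^ Suc k) has_real_derivative poly p x) (at x)"
    unfolding poly_eq_sum[OF assms(1)]
  proof (rule DERIV_sum)
    fix k
    have "((\<lambda>x. x ^ Suc k) has_real_derivative (1 + real k) * x ^ k) (at x)"
      using DERIV_pow[of "Suc k" x] by simp
    from DERIV_cmult[OF this, of "coeff p k / (real k + 1)"]
    show "((\<lambda>x. coeff p k / (real k + 1) * x ^ Suc k) has_real_derivative coeff p k * x ^ k) (at x)"
      by (simp add: add.commute)
  qed
  then show "((\<lambda>x. \<Sum>k<n. coeff p k / (real k + 1) * x ^ Suc k) has_vector_derivative poly p x)
      (at x within {a..b})"
    by (simp add: has_real_derivative_iff_has_vector_derivative has_vector_derivative_at_within)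
qed fact

section \<open>The curve in monomial form\<close>

text \<open>With \<open>m = n\<close> these are the coefficients of the derivative of the coordinate with control
  values \<open>w\<close>; \<open>m\<close> is the number of summands accumulated so far by the program. The quotients do
  not depend on the dimension, but recomputing them for each coordinate stays within the bound and
  needs storage for a single row only.\<close>

definition velocity_coeff :: "nat \<Rightarrow> (nat \<Rightarrow> real) \<Rightarrow> (nat \<Rightarrow> real) \<Rightarrow> nat \<Rightarrow> nat \<Rightarrow> real" where
  "velocity_coeff n \<tau> w m k =
     (\<Sum>i<m. (w (Suc i) - w i) * (real n * poly (legendre (n - 1)) (\<tau> (Suc i)) / 2) *
        coeff (synthetic_div (legendre n) (\<tau> (Suc i))) k)"

definition displacement :: "nat \<Rightarrow> (nat \<Rightarrow> real) \<Rightarrow> (nat \<Rightarrow> real) \<Rightarrow> real \<Rightarrow> real" where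
  "displacement n \<tau> w x = (\<Sum>k<n. velocity_coeff n \<tau> w n k / (real k + 1) * x ^ Suc k)"

text \<open>Summation by parts. The constants \<open>1/2\<close> and \<open>-1/2\<close> at both ends and the \<open>-1/2\<close> in each \<open>G\<close>
  combine to \<open>W 0 c\<close>, as the increments of \<open>W\<close> telescope.\<close>

lemma GL_curve_eq:
  assumes "n \<ge> 1" "-1 \<le> x"
  shows "GL_curve n \<tau> W x c =
    W 0 c + displacement n \<tau> (\<lambda>i. W i c) x - displacement n \<tau> (\<lambda>i. W i c) (-1)"
proof -
  define w where "w = (\<lambda>i. W i c)"
  define G where "G = (\<lambda>i. GL_G n \<tau> i x)"
  have abel: "(\<Sum>i = 0..m. w i * (G i - G (Suc i))) =
      w 0 * G 0 - w m * G (Suc m) + (\<Sum>i<m. (w (Suc i) - w i) * G (Suc i))" for m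
    by (induction m) (simp_all add: algebra_simps)
  have tele: "(\<Sum>i<m. w (Suc i) - w i) = w m - w 0" for m
    by (induction m) simp_all
  define Q where "Q = (\<lambda>i. synthetic_div (legendre n) (\<tau> (Suc i)))"
  define g where "g = (\<lambda>i. real n * poly (legendre (n - 1)) (\<tau> (Suc i)) / 2)"
  define A where "A = (\<lambda>i y. \<Sum>k<n. coeff (Q i) k / (real k + 1) * y ^ Suc k)"
  have deg: "degree (Q i) < n" for i
    using degree_legendre_le[of n] assms(1) by (simp add: Q_def degree_synthetic_div)
  have "integral {-1..x} (poly (Q i)) = A i x - A i (-1)" for i
    unfolding A_def by (rule integral_poly[OF deg assms(2)])
  then have Gi: "G (Suc i) = g i * (A i x - A i (-1)) - 1 / 2" if "i < n" for i
    using that by (simp add: G_def GL_G_def div_linear_eq_synthetic_div g_def Q_def)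
  have disp: "displacement n \<tau> w y = (\<Sum>i<n. (w (Suc i) - w i) * g i * A i y)" for y
    unfolding displacement_def velocity_coeff_def A_def g_def Q_def
    by (simp add: sum_distrib_left sum_distrib_right sum_divide_distrib mult_ac)
      (rule sum.swap)
  have "GL_curve n \<tau> W x c = (\<Sum>i = 0..n. w i * (G i - G (Suc i)))"
    by (simp add: GL_curve_def GL_F_def G_def w_def)
  also have "\<dots> = w 0 * G 0 - w n * G (Suc n) + (\<Sum>i<n. (w (Suc i) - w i) * G (Suc i))"
    by (rule abel)
  also have "(\<Sum>i<n. (w (Suc i) - w i) * G (Suc i)) =
      (\<Sum>i<n. (w (Suc i) - w i) * g i * A i x - (w (Suc i) - w i) * g i * A i (-1)
        - (w (Suc i) - w i) / 2)"
  proof (rule sum.cong[OF refl])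
    fix i assume "i \<in> {..<n}"
    moreover have "y * (g i * (a - b) - 1 / 2) = y * g i * a - y * g i * b - y / 2" for y a b
      by (simp add: algebra_simps)
    ultimately show "(w (Suc i) - w i) * G (Suc i) = (w (Suc i) - w i) * g i * A i x -
        (w (Suc i) - w i) * g i * A i (-1) - (w (Suc i) - w i) / 2"
      by (simp only: Gi lessThan_iff)
  qed
  also have "\<dots> = displacement n \<tau> w x - displacement n \<tau> w (-1) - (w n - w 0) / 2"
    using tele[of n] by (simp only: sum_subtractf disp flip: sum_divide_distrib)
  also have "w 0 * G 0 - w n * G (Suc n) = w 0 / 2 + w n / 2"
    by (simp add: G_def GL_G_def)
  finally show ?thesis
    by (simp add: w_def field_simps)
qed

section \<open>Horner evaluation\<close>

notation Seq (infixr ";;" 60)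

abbreviation scalar :: "string \<Rightarrow> cell" where
  "scalar a \<equiv> Cell a (INat 0)"

definition horner :: "string \<Rightarrow> cell \<Rightarrow> prog" where
  "horner a x =
     SetConst (scalar ''h'') 0 ;;
     For ''k'' (IReg ''n'')
       (Arith RMul (scalar ''h'') (scalar ''h'') x ;;
        Arith RAdd (scalar ''h'') (scalar ''h'')
          (Cell a (ISub (ISub (IReg ''n'') (INat 1)) (IReg ''k''))))"

lemma wregs_horner [simp]: "wregs (horner a x) = {''k''}"
  and warrs_horner [simp]: "warrs (horner a x) = {''h''}"
  by (auto simp: horner_def)

lemma horner_step:
  fixes f :: "nat \<Rightarrow> real"
  assumes "k < n"
  shows "(\<Sum>j<Suc k. f (n - Suc k + j) * x ^ j) = (\<Sum>j<k. f (n - k + j) * x ^ j) * x + f (n - 1 - k)"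
proof -
  have "n - Suc k + Suc j = n - k + j" for j
    using assms by simp
  note shift = this
  show ?thesis
    unfolding sum.lessThan_Suc_shift shift by (simp add: sum_distrib_left mult_ac)
qed

lemma runs_horner:
  assumes n: "reg s ''n'' = n" and ab: "a \<noteq> ''h''" "b \<noteq> ''h''" and e: "''k'' \<notin> iregs e"
  shows "runs (horner a (Cell b e)) s (n * 2)
    (\<lambda>s'. arr s' ''h'' 0 = (\<Sum>j<n. arr s a j * arr s b (ival e s) ^ j))"
proof -
  let ?x = "arr s b (ival e s)"
  let ?s = "store (scalar ''h'') 0 s"
  have "runs (For ''k'' (IReg ''n'')
       (Arith RMul (scalar ''h'') (scalar ''h'') (Cell b e) ;;
        Arith RAdd (scalar ''h'') (scalar ''h'')
          (Cell a (ISub (ISub (IReg ''n'') (INat 1)) (IReg ''k''))))) ?s (n * 2)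
    (\<lambda>s'. arr s' ''h'' 0 = (\<Sum>j<n. arr s a (n - n + j) * ?x ^ j))"
  proof (rule runs_For[where K = 2 and
        Inv = "\<lambda>k A. A ''h'' 0 = (\<Sum>j<k. arr s a (n - k + j) * ?x ^ j)"])
    fix k s1
    assume k: "k < n" "reg s1 ''k'' = k" and inv: "arr s1 ''h'' 0 = (\<Sum>j<k. arr s a (n - k + j) * ?x ^ j)"
      and fr: "frame (For ''k'' (IReg ''n'')
       (Arith RMul (scalar ''h'') (scalar ''h'') (Cell b e) ;;
        Arith RAdd (scalar ''h'') (scalar ''h'')
          (Cell a (ISub (ISub (IReg ''n'') (INat 1)) (IReg ''k''))))) ?s s1"
    have "reg s1 ''n'' = n" "arr s1 a = arr s a" "arr s1 b = arr s b"
      using fr n ab by (auto simp: frame_def)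
    moreover have "ival e s1 = ival e s"
      using ival_frame[OF fr, of e] e by (simp del: store.simps)
    ultimately show "runs (Arith RMul (scalar ''h'') (scalar ''h'') (Cell b e) ;;
        Arith RAdd (scalar ''h'') (scalar ''h'')
          (Cell a (ISub (ISub (IReg ''n'') (INat 1)) (IReg ''k'')))) s1 2
      (\<lambda>s'. arr s' ''h'' 0 = (\<Sum>j<Suc k. arr s a (n - Suc k + j) * ?x ^ j))"
      unfolding horner_step[OF k(1)]
      by (intro runs_Seq_Arith runs_Arith) (use k inv ab in simp_all)
  qed (use n in auto)
  then show ?thesis
    unfolding horner_def by (intro runs_Seq_SetConst) simp
qed

section \<open>Coefficients of Legendre polynomials\<close>

text \<open>Index registers cannot be converted to real numbers, so the integers that occur as divisors
  and derivative factors are tabulated by repeated addition.\<close>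

definition integers_prog :: prog where
  "integers_prog =
     SetConst (scalar ''num'') 0 ;;
     SetConst (scalar ''one'') 1 ;;
     For ''k'' (IAdd (IMul (INat 2) (IReg ''n'')) (INat 1))
       (Arith RAdd (Cell ''num'' (IAdd (IReg ''k'') (INat 1))) (Cell ''num'' (IReg ''k'')) (scalar ''one''))"

lemma wregs_integers [simp]: "wregs integers_prog = {''k''}"
  and warrs_integers [simp]: "warrs integers_prog = {''num'', ''one''}"
  by (auto simp: integers_prog_def)

lemma runs_integers:
  assumes n: "reg s ''n'' = n"
  shows "runs integers_prog s ((2 * n + 1) * 1) (\<lambda>s'. \<forall>k\<le>2 * n + 1. arr s' ''num'' k = real k)"
  unfolding integers_prog_def
proof (intro runs_Seq_SetConst, rule runs_For[where Inv = "\<lambda>i A. \<forall>k\<le>i. A ''num'' k = real k"])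
  fix i and s1 :: ram
  assume i: "reg s1 ''k'' = i" and inv: "\<forall>k\<le>i. arr s1 ''num'' k = real k"
    and fr: "frame (For ''k'' (IAdd (IMul (INat 2) (IReg ''n'')) (INat 1))
       (Arith RAdd (Cell ''num'' (IAdd (IReg ''k'') (INat 1))) (Cell ''num'' (IReg ''k'')) (scalar ''one'')))
       (store (scalar ''one'') (of_int 1) (store (scalar ''num'') (of_int 0) s)) s1"
  from fr have "arr s1 ''one'' 0 = 1" by (simp add: frame_def)
  then show "runs (Arith RAdd (Cell ''num'' (IAdd (IReg ''k'') (INat 1))) (Cell ''num'' (IReg ''k'')) (scalar ''one''))
       s1 1 (\<lambda>s'. \<forall>k\<le>Suc i. arr s' ''num'' k = real k)"
    by (intro runs_Arith) (use i inv in \<open>auto simp: le_Suc_eq\<close>)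
qed (use n in auto)

abbreviation twice_succ :: "iexp \<Rightarrow> iexp" where
  "twice_succ m \<equiv> IAdd (IMul (INat 2) m) (INat 1)"

text \<open>Multiplication by \<open>(x\<^sup>2 - 1) / (2 * i + 2)\<close>. It cannot be done in place in ascending order,
  as it uses the coefficients \<open>k - 2\<close> and \<open>k\<close> together; hence a copy in \<open>q\<close>, shifted by two
  places, whose two lowest cells hold the zeros that stand for the missing coefficients.\<close>

definition rodrigues_step :: "string \<Rightarrow> iexp \<Rightarrow> prog" where
  "rodrigues_step p m =
     For ''k'' (twice_succ m) (Copy (Cell ''q'' (IAdd (IReg ''k'') (INat 2))) (Cell p (IReg ''k''))) ;;
     For ''k'' (twice_succ m)
       (Arith RSub (Cell p (IReg ''k'')) (Cell ''q'' (IReg ''k'')) (Cell p (IReg ''k'')) ;;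
        Arith RDiv (Cell p (IReg ''k'')) (Cell p (IReg ''k''))
          (Cell ''num'' (IAdd (IMul (INat 2) (IReg ''i'')) (INat 2))))"

lemma wregs_rodrigues_step [simp]: "wregs (rodrigues_step p m) = {''k''}"
  and warrs_rodrigues_step [simp]: "warrs (rodrigues_step p m) = {''q'', p}"
  by (auto simp: rodrigues_step_def)

lemma runs_rodrigues_step:
  assumes p: "p \<noteq> ''q''" "p \<noteq> ''num''" and m: "''k'' \<notin> iregs m" "ival m s = l"
    and i: "arr s ''num'' (2 * reg s ''i'' + 2) = real (2 * reg s ''i'' + 2)"
    and q: "\<forall>k<2. arr s ''q'' k = 0"
  shows "runs (rodrigues_step p m) s (0 + (2 * l + 1) * 2) (\<lambda>s'. (\<forall>k<2. arr s' ''q'' k = 0) \<and>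
    (\<forall>k<2 * l + 1. arr s' p k =
      ((if k < 2 then 0 else arr s p (k - 2)) - arr s p k) / (2 * real (reg s ''i'') + 2)))"
  unfolding rodrigues_step_def
proof (rule runs_Seq)
  show "runs (For ''k'' (twice_succ m)
         (Copy (Cell ''q'' (IAdd (IReg ''k'') (INat 2))) (Cell p (IReg ''k'')))) s 0
    (\<lambda>s'. \<forall>k<2 * l + 1 + 2. arr s' ''q'' k = (if k < 2 then 0 else arr s p (k - 2)))"
  proof (rule runs_For[where K = 0 and N = "2 * l + 1" and
      Inv = "\<lambda>i A. \<forall>k<i + 2. A ''q'' k = (if k < 2 then 0 else arr s p (k - 2))", simplified mult_0_right])
    fix i s1
    assume "reg s1 ''k'' = i" "\<forall>k<i + 2. arr s1 ''q'' k = (if k < 2 then 0 else arr s p (k - 2))"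
      and fr: "frame (For ''k'' (twice_succ m)
         (Copy (Cell ''q'' (IAdd (IReg ''k'') (INat 2))) (Cell p (IReg ''k'')))) s s1"
    moreover from fr p have "arr s1 p = arr s p"
      by (simp add: frame_def)
    ultimately show "runs (Copy (Cell ''q'' (IAdd (IReg ''k'') (INat 2))) (Cell p (IReg ''k''))) s1 0
         (\<lambda>s'. \<forall>k<Suc i + 2. arr s' ''q'' k = (if k < 2 then 0 else arr s p (k - 2)))"
      by (auto simp: runs_Copy less_Suc_eq)
  qed (use m q in auto)
next
  let ?c = "For ''k'' (twice_succ m)
       (Arith RSub (Cell p (IReg ''k'')) (Cell ''q'' (IReg ''k'')) (Cell p (IReg ''k'')) ;;
        Arith RDiv (Cell p (IReg ''k'')) (Cell p (IReg ''k''))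
          (Cell ''num'' (IAdd (IMul (INat 2) (IReg ''i'')) (INat 2))))"
  let ?g = "\<lambda>k. ((if k < 2 then 0 else arr s p (k - 2)) - arr s p k) / (2 * real (reg s ''i'') + 2)"
  fix s1
  assume q1: "\<forall>k<2 * l + 1 + 2. arr s1 ''q'' k = (if k < 2 then 0 else arr s p (k - 2))"
    and fr: "frame (For ''k'' (twice_succ m)
         (Copy (Cell ''q'' (IAdd (IReg ''k'') (INat 2))) (Cell p (IReg ''k'')))) s s1"
  have 1: "reg s1 ''i'' = reg s ''i''" "arr s1 p = arr s p" "arr s1 ''num'' = arr s ''num''"
    using fr p by (auto simp: frame_def)
  have "ival m s1 = l"
    unfolding m(2)[symmetric] by (rule ival_frame[OF fr]) (use m in simp)
  have "runs ?c s1 ((2 * l + 1) * 2) (\<lambda>s'. \<forall>k. arr s' p k = (if k < 2 * l + 1 then ?g k else arr s p k))"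
  proof (rule runs_For[where Inv = "\<lambda>i A. \<forall>k. A p k = (if k < i then ?g k else arr s p k)"])
    fix k s2
    assume k: "k < 2 * l + 1" "reg s2 ''k'' = k" and fr: "frame ?c s1 s2"
      and inv: "\<forall>j. arr s2 p j = (if j < k then ?g j else arr s p j)"
    have "arr s2 ''q'' k = (if k < 2 then 0 else arr s p (k - 2))" "arr s2 p k = arr s p k"
      "arr s2 ''num'' (2 * reg s2 ''i'' + 2) = real (2 * reg s ''i'' + 2)"
      using fr p 1 q1 i k inv by (simp_all add: frame_def)
    then show "runs (Arith RSub (Cell p (IReg ''k'')) (Cell ''q'' (IReg ''k'')) (Cell p (IReg ''k'')) ;;
        Arith RDiv (Cell p (IReg ''k'')) (Cell p (IReg ''k''))
          (Cell ''num'' (IAdd (IMul (INat 2) (IReg ''i'')) (INat 2)))) s2 2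
         (\<lambda>s'. \<forall>j. arr s' p j = (if j < Suc k then ?g j else arr s p j))"
      using k inv p by (intro runs_Seq_Arith runs_Arith) (simp_all add: less_Suc_eq)
  qed (use m p 1 \<open>ival m s1 = l\<close> in auto)
  then show "runs ?c s1 ((2 * l + 1) * 2) (\<lambda>s'. (\<forall>k<2. arr s' ''q'' k = 0) \<and> (\<forall>k<2 * l + 1. arr s' p k = ?g k))"
    by (rule runs_mono) (use q1 p in \<open>auto simp: frame_def\<close>)
qed

text \<open>The second phase differentiates in place: coefficient \<open>k\<close> is overwritten only after its last
  use.\<close>

definition legendre_prog :: "string \<Rightarrow> iexp \<Rightarrow> prog" where
  "legendre_prog p m =
     SetConst (Cell ''q'' (INat 0)) 0 ;;
     SetConst (Cell ''q'' (INat 1)) 0 ;;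
     For ''k'' (twice_succ m) (SetConst (Cell p (IReg ''k'')) 0) ;;
     SetConst (scalar p) 1 ;;
     For ''i'' m (rodrigues_step p m) ;;
     For ''i'' m (For ''k'' (IMul (INat 2) m)
       (Arith RMul (Cell p (IReg ''k'')) (Cell ''num'' (IAdd (IReg ''k'') (INat 1)))
         (Cell p (IAdd (IReg ''k'') (INat 1)))))"

lemma wregs_legendre_prog [simp]: "wregs (legendre_prog p m) = {''i'', ''k''}"
  and warrs_legendre_prog [simp]: "warrs (legendre_prog p m) = {''q'', p}"
  by (auto simp: legendre_prog_def)

text \<open>Each derivative invalidates the topmost correct coefficient, since the cell above it is not
  maintained. Starting from the coefficients up to \<open>2 * l\<close>, those up to \<open>l\<close> are still
  correct after \<open>l\<close> derivatives, which is all that \<open>legendre l\<close> has.\<close>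

lemma runs_legendre_prog:
  assumes p: "p \<noteq> ''q''" "p \<noteq> ''num''" and m: "iregs m \<inter> {''i'', ''k''} = {}" "ival m s = l"
    and num: "\<forall>k\<le>2 * l + 1. arr s ''num'' k = real k"
  shows "runs (legendre_prog p m) s (0 + (l * ((2 * l + 1) * 2) + l * (2 * l * 1)))
    (\<lambda>s'. \<forall>k\<le>l. arr s' p k = coeff (legendre l) k)"
proof -
  let ?zero = "For ''k'' (twice_succ m) (SetConst (Cell p (IReg ''k'')) 0)"
  let ?mult = "For ''i'' m (rodrigues_step p m)"
  let ?deriv = "For ''k'' (IMul (INat 2) m)
       (Arith RMul (Cell p (IReg ''k'')) (Cell ''num'' (IAdd (IReg ''k'') (INat 1)))
         (Cell p (IAdd (IReg ''k'') (INat 1))))"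
  have zero: "runs ?zero s1 ((2 * l + 1) * 0) (\<lambda>s'. \<forall>k<2 * l + 1. arr s' p k = 0)"
    if "ival m s1 = l" for s1
    by (rule runs_For[where Inv = "\<lambda>i A. \<forall>k<i. A p k = 0"])
      (use m that in \<open>auto simp: runs_SetConst less_Suc_eq\<close>)
  have mult: "runs ?mult s1 (l * ((2 * l + 1) * 2)) (\<lambda>s'. \<forall>k<2 * l + 1. arr s' p k = coeff (rodrigues l) k)"
    if s1: "ival m s1 = l" "\<forall>k\<le>2 * l + 1. arr s1 ''num'' k = real k" "\<forall>k<2. arr s1 ''q'' k = 0"
      "\<forall>k<2 * l + 1. arr s1 p k = (if k = 0 then 1 else 0)" for s1
  proof -
    have "runs ?mult s1 (l * ((2 * l + 1) * 2)) (\<lambda>s'. (\<forall>k<2. arr s' ''q'' k = 0) \<and>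
        (\<forall>k<2 * l + 1. arr s' p k = coeff (rodrigues l) k))"
    proof (rule runs_For[where Inv = "\<lambda>i A. (\<forall>k<2. A ''q'' k = 0) \<and>
        (\<forall>k<2 * l + 1. A p k = coeff (rodrigues i) k)"])
      fix i s2
      assume i: "i < l" "reg s2 ''i'' = i" and fr: "frame ?mult s1 s2"
        and inv: "(\<forall>k<2. arr s2 ''q'' k = 0) \<and> (\<forall>k<2 * l + 1. arr s2 p k = coeff (rodrigues i) k)"
      have "ival m s2 = l"
        using ival_frame[OF fr, of m] m s1(1) by (simp add: Int_commute)
      moreover have "arr s2 ''num'' (2 * reg s2 ''i'' + 2) = real (2 * reg s2 ''i'' + 2)"
        using fr i s1(2) p by (simp add: frame_def)
      ultimately have "runs (rodrigues_step p m) s2 (0 + (2 * l + 1) * 2) (\<lambda>s'. (\<forall>k<2. arr s' ''q'' k = 0) \<and>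
          (\<forall>k<2 * l + 1. arr s' p k =
            ((if k < 2 then 0 else arr s2 p (k - 2)) - arr s2 p k) / (2 * real (reg s2 ''i'') + 2)))"
        by (intro runs_rodrigues_step) (use p m inv in auto)
      then show "runs (rodrigues_step p m) s2 ((2 * l + 1) * 2) (\<lambda>s'. (\<forall>k<2. arr s' ''q'' k = 0) \<and>
          (\<forall>k<2 * l + 1. arr s' p k = coeff (rodrigues (Suc i)) k))"
        by (rule runs_mono) (use i inv in \<open>auto simp: coeff_rodrigues_Suc\<close>)
    qed (use m s1 in \<open>auto simp: coeff_rodrigues_0\<close>)
    then show ?thesis by (rule runs_mono) auto
  qed
  have deriv: "runs (For ''i'' m ?deriv) s1 (l * (2 * l * 1))
      (\<lambda>s'. \<forall>k\<le>2 * l - l. arr s' p k = coeff ((pderiv ^^ l) (rodrigues l)) k)"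
    if s1: "ival m s1 = l" "\<forall>k\<le>2 * l + 1. arr s1 ''num'' k = real k"
      "\<forall>k<2 * l + 1. arr s1 p k = coeff (rodrigues l) k" for s1
  proof (rule runs_For[where Inv = "\<lambda>i A. \<forall>k\<le>2 * l - i. A p k = coeff ((pderiv ^^ i) (rodrigues l)) k"])
    fix i s2
    assume i: "i < l" "reg s2 ''i'' = i" and fr: "frame (For ''i'' m ?deriv) s1 s2"
      and inv: "\<forall>k\<le>2 * l - i. arr s2 p k = coeff ((pderiv ^^ i) (rodrigues l)) k"
    have 2: "ival m s2 = l"
      using ival_frame[OF fr, of m] m s1(1) by (simp add: Int_commute)
    have num2: "\<forall>k\<le>2 * l + 1. arr s2 ''num'' k = real k"
      using fr s1(2) p by (simp add: frame_def)
    have "runs ?deriv s2 (2 * l * 1)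
      (\<lambda>s'. \<forall>j. arr s' p j = (if j < 2 * l then real (j + 1) * arr s2 p (j + 1) else arr s2 p j))"
    proof (rule runs_For[where Inv = "\<lambda>k A. \<forall>j. A p j = (if j < k then real (j + 1) * arr s2 p (j + 1) else arr s2 p j)"])
      fix k s3
      assume k: "k < 2 * l" "reg s3 ''k'' = k" and fr: "frame ?deriv s2 s3"
        and inv: "\<forall>j. arr s3 p j = (if j < k then real (j + 1) * arr s2 p (j + 1) else arr s2 p j)"
      have "arr s3 ''num'' (k + 1) = real (k + 1)"
        using fr num2 p k by (simp add: frame_def)
      then show "runs (Arith RMul (Cell p (IReg ''k'')) (Cell ''num'' (IAdd (IReg ''k'') (INat 1)))
         (Cell p (IAdd (IReg ''k'') (INat 1)))) s3 1
         (\<lambda>s'. \<forall>j. arr s' p j = (if j < Suc k then real (j + 1) * arr s2 p (j + 1) else arr s2 p j))"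
        using k inv p by (intro runs_Arith) (auto simp: less_Suc_eq)
    qed (use 2 m in auto)
    then show "runs ?deriv s2 (2 * l * 1)
        (\<lambda>s'. \<forall>k\<le>2 * l - Suc i. arr s' p k = coeff ((pderiv ^^ Suc i) (rodrigues l)) k)"
      by (rule runs_mono) (use i inv in \<open>auto simp: coeff_pderiv\<close>)
  qed (use m s1 in auto)
  let ?s = "store (Cell ''q'' (INat 1)) 0 (store (Cell ''q'' (INat 0)) 0 s)"
  have "runs (?zero ;; SetConst (scalar p) 1 ;; ?mult ;; For ''i'' m ?deriv) ?s
      ((2 * l + 1) * 0 + (l * ((2 * l + 1) * 2) + l * (2 * l * 1)))
      (\<lambda>s'. \<forall>k\<le>2 * l - l. arr s' p k = coeff ((pderiv ^^ l) (rodrigues l)) k)"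
  proof (rule runs_Seq[OF zero])
    show "ival m ?s = l"
      using m(2) by (simp del: store.simps)
    fix s1
    assume z: "\<forall>k<2 * l + 1. arr s1 p k = 0" and fr: "frame ?zero ?s s1"
    let ?s1 = "store (scalar p) (of_int 1) s1"
    have m1: "ival m ?s1 = l"
      using ival_frame[OF fr, of m] m by (simp del: store.simps add: Int_commute)
    have num1: "\<forall>k\<le>2 * l + 1. arr ?s1 ''num'' k = real k"
      using fr num p by (auto simp: frame_def)
    have "runs (?mult ;; For ''i'' m ?deriv) ?s1 (l * ((2 * l + 1) * 2) + l * (2 * l * 1))
      (\<lambda>s'. \<forall>k\<le>2 * l - l. arr s' p k = coeff ((pderiv ^^ l) (rodrigues l)) k)"
    proof (rule runs_Seq[OF mult[OF m1 num1] deriv])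
      show "\<forall>k<2. arr ?s1 ''q'' k = 0"
        using fr p by (auto simp: frame_def less_2_cases_iff)
      show "\<forall>k<2 * l + 1. arr ?s1 p k = (if k = 0 then 1 else 0)"
        using z by auto
      fix s2 assume fr: "frame ?mult ?s1 s2"
      show "ival m s2 = l"
        using ival_frame[OF fr, of m] m m1 by (simp del: store.simps add: Int_commute)
      show "\<forall>k\<le>2 * l + 1. arr s2 ''num'' k = real k"
        using fr num1 p by (auto simp: frame_def)
    qed
    then show "runs (SetConst (scalar p) 1 ;; ?mult ;; For ''i'' m ?deriv) s1
      (l * ((2 * l + 1) * 2) + l * (2 * l * 1))
      (\<lambda>s'. \<forall>k\<le>2 * l - l. arr s' p k = coeff ((pderiv ^^ l) (rodrigues l)) k)"
      by (rule runs_Seq_SetConst)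
  qed
  then show ?thesis
    unfolding legendre_prog_def legendre_rodrigues by (intro runs_Seq_SetConst) simp
qed

section \<open>One coordinate of the curve\<close>

text \<open>Synthetic division of \<open>P\<close>, whose coefficients appear in \<open>b\<close> one after another from the
  leading one downwards. They are multiplied by the weight \<open>u\<close> and added to \<open>D\<close> as they appear,
  so the quotient is never stored.\<close>

definition quotient_prog :: prog where
  "quotient_prog =
     SetConst (scalar ''b'') 0 ;;
     For ''k'' (IReg ''n'')
       (Arith RMul (scalar ''b'') (scalar ''b'') (Cell ''tau'' (IAdd (IReg ''i'') (INat 1))) ;;
        Arith RAdd (scalar ''b'') (scalar ''b'') (Cell ''P'' (ISub (IReg ''n'') (IReg ''k''))) ;;
        Arith RMul (scalar ''v'') (scalar ''b'') (scalar ''u'') ;;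
        Arith RAdd (Cell ''D'' (ISub (ISub (IReg ''n'') (INat 1)) (IReg ''k'')))
          (Cell ''D'' (ISub (ISub (IReg ''n'') (INat 1)) (IReg ''k''))) (scalar ''v''))"

lemma wregs_quotient [simp]: "wregs quotient_prog = {''k''}"
  and warrs_quotient [simp]: "warrs quotient_prog = {''b'', ''v'', ''D''}"
  by (auto simp: quotient_prog_def)

lemma runs_quotient:
  assumes n: "reg s ''n'' = n" and P: "\<forall>k\<le>n. arr s ''P'' k = coeff p k" and deg: "degree p \<le> n"
  shows "runs quotient_prog s (n * 4) (\<lambda>s'. \<forall>k<n. arr s' ''D'' k =
    arr s ''D'' k + coeff (synthetic_div p (arr s ''tau'' (reg s ''i'' + 1))) k * arr s ''u'' 0)"
proof -
  define a where "a = arr s ''tau'' (reg s ''i'' + 1)"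
  define q where "q = synthetic_div p a"
  define u where "u = arr s ''u'' 0"
  \<comment> \<open>This is why \<open>b\<close> starts at 0: it then equals coefficient \<open>n - k\<close> after \<open>k\<close> steps.\<close>
  have q_n: "coeff q n = 0"
  proof (cases "degree p = 0")
    case True
    then show ?thesis using synthetic_div_eq_0_iff[of p a] by (simp add: q_def)
  next
    case False
    then show ?thesis using deg by (intro coeff_eq_0) (simp add: q_def degree_synthetic_div)
  qed
  let ?Inv = "\<lambda>k (A :: string \<Rightarrow> nat \<Rightarrow> real). A ''b'' 0 = coeff q (n - k) \<and>
    (\<forall>j<n. A ''D'' j = arr s ''D'' j + (if n - k \<le> j then coeff q j * u else 0))"
  let ?body = "Arith RMul (scalar ''b'') (scalar ''b'') (Cell ''tau'' (IAdd (IReg ''i'') (INat 1))) ;;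
        Arith RAdd (scalar ''b'') (scalar ''b'') (Cell ''P'' (ISub (IReg ''n'') (IReg ''k''))) ;;
        Arith RMul (scalar ''v'') (scalar ''b'') (scalar ''u'') ;;
        Arith RAdd (Cell ''D'' (ISub (ISub (IReg ''n'') (INat 1)) (IReg ''k'')))
          (Cell ''D'' (ISub (ISub (IReg ''n'') (INat 1)) (IReg ''k''))) (scalar ''v'')"
  let ?s = "store (scalar ''b'') (of_int 0) s"
  have "runs (For ''k'' (IReg ''n'') ?body) ?s (n * 4) (\<lambda>s'. ?Inv n (arr s'))"
  proof (rule runs_For[where Inv = ?Inv])
    fix k s1
    assume k: "k < n" "reg s1 ''k'' = k" and fr: "frame (For ''k'' (IReg ''n'') ?body) ?s s1"
      and inv: "?Inv k (arr s1)"
    have s1: "reg s1 ''n'' = n" "arr s1 ''tau'' (reg s1 ''i'' + 1) = a" "arr s1 ''u'' 0 = u"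
        "arr s1 ''P'' (n - k) = coeff p (n - k)"
      using fr n P by (auto simp: frame_def a_def u_def)
    have b: "coeff q (n - Suc k) = coeff q (n - k) * a + coeff p (n - k)"
      using coeff_synthetic_div[of p a "n - Suc k"] k by (simp add: q_def Suc_diff_Suc)
    have D: "arr s1 ''D'' (n - Suc k) = arr s ''D'' (n - Suc k)"
      using inv k by auto
    have cases: "n - Suc k \<le> j \<longleftrightarrow> j = n - Suc k \<or> n - k \<le> j" for j
      using k by auto
    show "runs ?body s1 4 (\<lambda>s'. ?Inv (Suc k) (arr s'))"
      by (intro runs_Seq_Arith runs_Arith) (use k s1 b D inv in \<open>auto simp: cases\<close>)
  qed (use n q_n in auto)
  then have "runs (For ''k'' (IReg ''n'') ?body) ?s (n * 4)
      (\<lambda>s'. \<forall>k<n. arr s' ''D'' k = arr s ''D'' k + coeff q k * u)"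
    by (rule runs_mono) auto
  then show ?thesis
    unfolding quotient_prog_def q_def a_def u_def by (rule runs_Seq_SetConst)
qed

definition velocity_step :: prog where
  "velocity_step =
     horner ''R'' (Cell ''tau'' (IAdd (IReg ''i'') (INat 1))) ;;
     Arith RMul (scalar ''h'') (scalar ''h'') (Cell ''num'' (IReg ''n'')) ;;
     Arith RDiv (scalar ''h'') (scalar ''h'') (Cell ''num'' (INat 2)) ;;
     Arith RSub (scalar ''u'')
       (Cell ''W'' (IAdd (IMul (IAdd (IReg ''i'') (INat 1)) (IReg ''d'')) (IReg ''c'')))
       (Cell ''W'' (IAdd (IMul (IReg ''i'') (IReg ''d'')) (IReg ''c''))) ;;
     Arith RMul (scalar ''u'') (scalar ''u'') (scalar ''h'') ;;
     quotient_prog"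

lemma wregs_velocity_step [simp]: "wregs velocity_step = {''k''}"
  and warrs_velocity_step [simp]: "warrs velocity_step = {''h'', ''u'', ''b'', ''v'', ''D''}"
  by (auto simp: velocity_step_def)

text \<open>What the computation of a coordinate may rely on. No coordinate program writes to these
  arrays, so the condition persists through the outer loop by \<open>prepared_frame\<close>.\<close>

definition prepared :: "nat \<Rightarrow> nat \<Rightarrow> nat \<Rightarrow> (nat \<Rightarrow> real) \<Rightarrow> (nat \<Rightarrow> point) \<Rightarrow> (nat \<Rightarrow> real) \<Rightarrow> ram \<Rightarrow> bool" where
  "prepared n d M \<tau> W t s \<longleftrightarrow> has_input s n d M \<tau> W t \<and>
     (\<forall>k\<le>2 * n + 1. arr s ''num'' k = real k) \<and>
     (\<forall>k\<le>n. arr s ''P'' k = coeff (legendre n) k) \<and>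
     (\<forall>k\<le>n - 1. arr s ''R'' k = coeff (legendre (n - 1)) k)"

lemma prepared_frame:
  assumes "prepared n d M \<tau> W t s" "frame c s s'" "{''n'', ''d'', ''M''} \<inter> wregs c = {}"
    "{''tau'', ''W'', ''t'', ''num'', ''P'', ''R''} \<inter> warrs c = {}"
  shows "prepared n d M \<tau> W t s'"
  using assms by (simp add: prepared_def has_input_def frame_def)

lemma runs_velocity_step:
  assumes pre: "prepared n d M \<tau> W t s" and n: "n \<ge> 1" and i: "reg s ''i'' = i" "i < n"
    and c: "reg s ''c'' = c" "c < d"
  shows "runs velocity_step s (n * 2 + (4 + n * 4)) (\<lambda>s'. \<forall>k<n. arr s' ''D'' k = arr s ''D'' k +
    (W (Suc i) c - W i c) * (real n * poly (legendre (n - 1)) (\<tau> (Suc i)) / 2) *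
      coeff (synthetic_div (legendre n) (\<tau> (Suc i))) k)"
  unfolding velocity_step_def
proof (rule runs_Seq[OF runs_horner])
  show "reg s ''n'' = n"
    using pre by (simp add: prepared_def has_input_def)
  fix s1
  assume h: "arr s1 ''h'' 0 = (\<Sum>j<n. arr s ''R'' j *
      arr s ''tau'' (ival (IAdd (IReg ''i'') (INat 1)) s) ^ j)"
    and fr: "frame (horner ''R'' (Cell ''tau'' (IAdd (IReg ''i'') (INat 1)))) s s1"
  have pre1: "prepared n d M \<tau> W t s1"
    by (rule prepared_frame[OF pre fr]) auto
  have s1: "reg s1 ''i'' = i" "reg s1 ''c'' = c" "arr s1 ''D'' = arr s ''D''" "reg s1 ''n'' = n"
      "reg s1 ''d'' = d" "arr s1 ''num'' n = real n" "arr s1 ''num'' 2 = 2"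
      "arr s1 ''tau'' (Suc i) = \<tau> (Suc i)" "\<forall>k\<le>n. arr s1 ''P'' k = coeff (legendre n) k"
    using fr i c n pre1 by (auto simp: frame_def prepared_def has_input_def)
  have "arr s1 ''W'' (i' * d + c) = W i' c" if "i' \<le> n" for i'
    using pre1 c that by (auto simp: prepared_def has_input_def)
  from this[of i] this[of "Suc i"] i
  have W: "arr s1 ''W'' (i * d + c) = W i c" "arr s1 ''W'' (Suc i * d + c) = W (Suc i) c"
    by simp_all
  have "poly (legendre (n - 1)) (\<tau> (Suc i)) = (\<Sum>k<n. coeff (legendre (n - 1)) k * \<tau> (Suc i) ^ k)"
    using degree_legendre_le[of "n - 1"] n by (intro poly_eq_sum) simp
  also have "\<dots> = arr s1 ''h'' 0"
    unfolding h using pre i by (intro sum.cong) (auto simp: prepared_def has_input_def)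
  finally have h1: "arr s1 ''h'' 0 = poly (legendre (n - 1)) (\<tau> (Suc i))" ..
  define g where "g = real n * poly (legendre (n - 1)) (\<tau> (Suc i)) / 2"
  define s2 where "s2 = s1\<lparr>arr := (arr s1)(''h'' := (arr s1 ''h'')(0 := g),
      ''u'' := (arr s1 ''u'')(0 := (W (Suc i) c - W i c) * g))\<rparr>"
  have "runs quotient_prog s2 (n * 4) (\<lambda>s'. \<forall>k<n. arr s' ''D'' k =
      arr s2 ''D'' k + coeff (synthetic_div (legendre n) (arr s2 ''tau'' (reg s2 ''i'' + 1))) k * arr s2 ''u'' 0)"
    by (rule runs_quotient) (use s1 degree_legendre_le in \<open>auto simp: s2_def\<close>)
  then have q: "runs quotient_prog s2 (n * 4) (\<lambda>s'. \<forall>k<n. arr s' ''D'' k = arr s ''D'' k +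
    (W (Suc i) c - W i c) * g * coeff (synthetic_div (legendre n) (\<tau> (Suc i))) k)"
    by (rule runs_mono) (use s1 in \<open>auto simp: s2_def\<close>)
  show "runs (Arith RMul (scalar ''h'') (scalar ''h'') (Cell ''num'' (IReg ''n'')) ;;
     Arith RDiv (scalar ''h'') (scalar ''h'') (Cell ''num'' (INat 2)) ;;
     Arith RSub (scalar ''u'')
       (Cell ''W'' (IAdd (IMul (IAdd (IReg ''i'') (INat 1)) (IReg ''d'')) (IReg ''c'')))
       (Cell ''W'' (IAdd (IMul (IReg ''i'') (IReg ''d'')) (IReg ''c''))) ;;
     Arith RMul (scalar ''u'') (scalar ''u'') (scalar ''h'') ;;
     quotient_prog) s1 (4 + n * 4) (\<lambda>s'. \<forall>k<n. arr s' ''D'' k = arr s ''D'' k +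
    (W (Suc i) c - W i c) * (real n * poly (legendre (n - 1)) (\<tau> (Suc i)) / 2) *
      coeff (synthetic_div (legendre n) (\<tau> (Suc i))) k)"
    unfolding g_def[symmetric]
    by (intro runs_Seq_Arith)
      (use q s1 W h1 in \<open>simp_all add: s2_def g_def mult.commute fun_upd_twist\<close>)
qed simp_all

text \<open>The final loop replaces the coefficients of the derivative by \<open>D k / (k + 1)\<close>, the
  coefficients of its antiderivative shifted down by one; Horner evaluation of \<open>D\<close> therefore has to
  be followed by one more multiplication by the argument.\<close>

definition velocity_prog :: prog where
  "velocity_prog =
     For ''k'' (IReg ''n'') (SetConst (Cell ''D'' (IReg ''k'')) 0) ;;
     For ''i'' (IReg ''n'') velocity_step ;;
     For ''k'' (IReg ''n'')
       (Arith RDiv (Cell ''D'' (IReg ''k'')) (Cell ''D'' (IReg ''k''))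
         (Cell ''num'' (IAdd (IReg ''k'') (INat 1))))"

lemma wregs_velocity_prog [simp]: "wregs velocity_prog = {''i'', ''k''}"
  and warrs_velocity_prog [simp]: "warrs velocity_prog = {''h'', ''u'', ''b'', ''v'', ''D''}"
  by (auto simp: velocity_prog_def)

lemma runs_velocity_prog:
  assumes pre: "prepared n d M \<tau> W t s" and n: "n \<ge> 1" and c: "reg s ''c'' = c" "c < d"
  shows "runs velocity_prog s (n * 0 + (n * (n * 2 + (4 + n * 4)) + n * 1))
    (\<lambda>s'. \<forall>k<n. arr s' ''D'' k = velocity_coeff n \<tau> (\<lambda>i. W i c) n k / (real k + 1))"
  unfolding velocity_prog_def
proof (rule runs_Seq)
  have regn: "reg s ''n'' = n" if "prepared n d M \<tau> W t s" for s
    using that by (simp add: prepared_def has_input_def)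
  let ?zero = "For ''k'' (IReg ''n'') (SetConst (Cell ''D'' (IReg ''k'')) 0)"
  let ?sum = "For ''i'' (IReg ''n'') velocity_step"
  let ?body = "Arith RDiv (Cell ''D'' (IReg ''k'')) (Cell ''D'' (IReg ''k''))
         (Cell ''num'' (IAdd (IReg ''k'') (INat 1)))"
  show "runs ?zero s (n * 0) (\<lambda>s'. \<forall>k<n. arr s' ''D'' k = 0)"
    by (rule runs_For[where Inv = "\<lambda>i A. \<forall>k<i. A ''D'' k = 0"])
      (use regn[OF pre] in \<open>auto simp: runs_SetConst less_Suc_eq\<close>)
  fix s1
  assume z: "\<forall>k<n. arr s1 ''D'' k = 0" and fr1: "frame ?zero s s1"
  have pre1: "prepared n d M \<tau> W t s1"
    by (rule prepared_frame[OF pre fr1]) auto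
  have c1: "reg s1 ''c'' = c"
    using fr1 c by (simp add: frame_def)
  show "runs (?sum ;; For ''k'' (IReg ''n'') ?body) s1 (n * (n * 2 + (4 + n * 4)) + n * 1)
    (\<lambda>s'. \<forall>k<n. arr s' ''D'' k = velocity_coeff n \<tau> (\<lambda>i. W i c) n k / (real k + 1))"
  proof (rule runs_Seq)
    show "runs ?sum s1 (n * (n * 2 + (4 + n * 4)))
      (\<lambda>s'. \<forall>k<n. arr s' ''D'' k = velocity_coeff n \<tau> (\<lambda>i. W i c) n k)"
    proof (rule runs_For[where Inv = "\<lambda>m A. \<forall>k<n. A ''D'' k = velocity_coeff n \<tau> (\<lambda>i. W i c) m k"])
      fix i s2
      assume i: "i < n" "reg s2 ''i'' = i" and fr: "frame ?sum s1 s2"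
        and inv: "\<forall>k<n. arr s2 ''D'' k = velocity_coeff n \<tau> (\<lambda>i. W i c) i k"
      have pre2: "prepared n d M \<tau> W t s2"
        by (rule prepared_frame[OF pre1 fr]) auto
      have "reg s2 ''c'' = c"
        using fr c1 by (simp add: frame_def)
      from runs_velocity_step[OF pre2 n i(2,1) this c(2)]
      show "runs velocity_step s2 (n * 2 + (4 + n * 4))
          (\<lambda>s'. \<forall>k<n. arr s' ''D'' k = velocity_coeff n \<tau> (\<lambda>i. W i c) (Suc i) k)"
        by (rule runs_mono) (use inv in \<open>auto simp: velocity_coeff_def\<close>)
    qed (use z regn[OF pre1] in \<open>auto simp: velocity_coeff_def\<close>)
    fix s2
    assume D: "\<forall>k<n. arr s2 ''D'' k = velocity_coeff n \<tau> (\<lambda>i. W i c) n k" and fr2: "frame ?sum s1 s2"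
    have pre2: "prepared n d M \<tau> W t s2"
      by (rule prepared_frame[OF pre1 fr2]) auto
    have "runs (For ''k'' (IReg ''n'') ?body) s2 (n * 1) (\<lambda>s'. \<forall>j. arr s' ''D'' j =
        (if j < n then arr s2 ''D'' j / (real j + 1) else arr s2 ''D'' j))"
    proof (rule runs_For[where Inv = "\<lambda>k A. \<forall>j. A ''D'' j =
        (if j < k then arr s2 ''D'' j / (real j + 1) else arr s2 ''D'' j)"])
      fix k s3
      assume k: "k < n" "reg s3 ''k'' = k" and fr: "frame (For ''k'' (IReg ''n'') ?body) s2 s3"
        and inv: "\<forall>j. arr s3 ''D'' j = (if j < k then arr s2 ''D'' j / (real j + 1) else arr s2 ''D'' j)"
      have "arr s3 ''num'' (k + 1) = real (k + 1)"
        using fr pre2 k by (simp add: frame_def prepared_def)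
      then show "runs ?body s3 1 (\<lambda>s'. \<forall>j. arr s' ''D'' j =
          (if j < Suc k then arr s2 ''D'' j / (real j + 1) else arr s2 ''D'' j))"
        using k inv by (intro runs_Arith) (auto simp: less_Suc_eq add.commute)
    qed (use regn[OF pre2] in auto)
    then show "runs (For ''k'' (IReg ''n'') ?body) s2 (n * 1)
        (\<lambda>s'. \<forall>k<n. arr s' ''D'' k = velocity_coeff n \<tau> (\<lambda>i. W i c) n k / (real k + 1))"
      by (rule runs_mono) (use D in auto)
  qed
qed

definition displacement_prog :: "cell \<Rightarrow> prog" where
  "displacement_prog x = horner ''D'' x ;; Arith RMul (scalar ''h'') (scalar ''h'') x"

lemma wregs_displacement_prog [simp]: "wregs (displacement_prog x) = {''k''}"
  and warrs_displacement_prog [simp]: "warrs (displacement_prog x) = {''h''}"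
  by (auto simp: displacement_prog_def)

lemma runs_displacement_prog:
  assumes n: "reg s ''n'' = n" and b: "b \<noteq> ''h''" and e: "''k'' \<notin> iregs e"
    and D: "\<forall>k<n. arr s ''D'' k = velocity_coeff n \<tau> w n k / (real k + 1)"
  shows "runs (displacement_prog (Cell b e)) s (n * 2 + 1)
    (\<lambda>s'. arr s' ''h'' 0 = displacement n \<tau> w (arr s b (ival e s)))"
  unfolding displacement_prog_def
proof (rule runs_Seq[OF runs_horner[OF n _ b e]])
  let ?x = "arr s b (ival e s)"
  fix s1
  assume h: "arr s1 ''h'' 0 = (\<Sum>j<n. arr s ''D'' j * ?x ^ j)" and fr: "frame (horner ''D'' (Cell b e)) s s1"
  have "arr s1 b (ival e s1) = ?x"
    using ival_frame[OF fr, of e] fr b e by (simp add: frame_def)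
  moreover have "(\<Sum>j<n. arr s ''D'' j * ?x ^ j) * ?x = displacement n \<tau> w ?x"
    unfolding displacement_def sum_distrib_right using D by (intro sum.cong) simp_all
  ultimately show "runs (Arith RMul (scalar ''h'') (scalar ''h'') (Cell b e)) s1 1
      (\<lambda>s'. arr s' ''h'' 0 = displacement n \<tau> w ?x)"
    by (intro runs_Arith) (simp_all add: h)
qed simp

definition coordinate_prog :: prog where
  "coordinate_prog =
     velocity_prog ;;
     SetConst (scalar ''x'') (-1) ;;
     displacement_prog (scalar ''x'') ;;
     Arith RSub (scalar ''base'') (Cell ''W'' (IReg ''c'')) (scalar ''h'') ;;
     For ''j'' (IAdd (IReg ''M'') (INat 1))
       (displacement_prog (Cell ''t'' (IReg ''j'')) ;;
        Arith RAdd (Cell ''out'' (IAdd (IMul (IReg ''j'') (IReg ''d'')) (IReg ''c'')))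
          (scalar ''h'') (scalar ''base''))"

lemma wregs_coordinate_prog [simp]: "wregs coordinate_prog = {''i'', ''j'', ''k''}"
  and warrs_coordinate_prog [simp]:
    "warrs coordinate_prog = {''h'', ''u'', ''b'', ''v'', ''D'', ''x'', ''base'', ''out''}"
  by (auto simp: coordinate_prog_def)

lemma row_major_inj:
  fixes c d :: nat
  assumes "c < d" "c' < d"
  shows "j * d + c = j' * d + c' \<longleftrightarrow> j = j' \<and> c = c'"
proof
  assume eq: "j * d + c = j' * d + c'"
  have "(j * d + c) div d = j" "(j' * d + c') div d = j'"
    using assms by simp_all
  with eq show "j = j' \<and> c = c'" by simp
qed simp

text \<open>The cost functions are left in the form in which the rules for sequences and loops produce
  them.\<close>

definition coordinate_cost :: "nat \<Rightarrow> nat \<Rightarrow> nat" where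
  "coordinate_cost n M = n * 0 + (n * (n * 2 + (4 + n * 4)) + n * 1) +
     ((n * 2 + 1) + (1 + (M + 1) * ((n * 2 + 1) + 1)))"

text \<open>The postcondition also says that the other coordinates of the output are kept, since
  all coordinates share the array \<open>out\<close> and the syntactic frame condition says nothing about it.\<close>

lemma runs_coordinate_prog:
  assumes pre: "prepared n d M \<tau> W t s" and n: "n \<ge> 1" and c: "reg s ''c'' = c" "c < d"
    and t: "\<forall>j\<le>M. -1 \<le> t j"
  shows "runs coordinate_prog s (coordinate_cost n M) (\<lambda>s'. \<forall>j\<le>M. \<forall>c'<d.
    arr s' ''out'' (j * d + c') =
      (if c' = c then GL_curve n \<tau> W (t j) c else arr s ''out'' (j * d + c')))"
  unfolding coordinate_prog_def coordinate_cost_def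
proof (rule runs_Seq[OF runs_velocity_prog[OF pre n c]], rule runs_Seq_SetConst)
  have prepD: "reg s ''n'' = n" "reg s ''d'' = d" "reg s ''M'' = M" "\<forall>j\<le>M. arr s ''t'' j = t j"
    if "prepared n d M \<tau> W t s" for s
    using that by (auto simp: prepared_def has_input_def)
  let ?dis = "displacement n \<tau> (\<lambda>i. W i c)"
  let ?D = "\<lambda>s. \<forall>k<n. arr s ''D'' k = velocity_coeff n \<tau> (\<lambda>i. W i c) n k / (real k + 1)"
  let ?base = "Arith RSub (scalar ''base'') (Cell ''W'' (IReg ''c'')) (scalar ''h'')"
  let ?body = "displacement_prog (Cell ''t'' (IReg ''j'')) ;;
        Arith RAdd (Cell ''out'' (IAdd (IMul (IReg ''j'') (IReg ''d'')) (IReg ''c'')))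
          (scalar ''h'') (scalar ''base'')"
  let ?loop = "For ''j'' (IAdd (IReg ''M'') (INat 1)) ?body"
  let ?Q = "\<lambda>m A. \<forall>j\<le>M. \<forall>c'<d. A ''out'' (j * d + c') =
      (if j < m \<and> c' = c then GL_curve n \<tau> W (t j) c else arr s ''out'' (j * d + c'))"
  fix s0
  assume D0: "?D s0" and fr0: "frame velocity_prog s s0"
  define s1 where "s1 = store (scalar ''x'') (of_int (-1)) s0"
  have "prepared n d M \<tau> W t s0"
    by (rule prepared_frame[OF pre fr0]) auto
  then have pre1: "prepared n d M \<tau> W t s1"
    by (simp add: prepared_def has_input_def s1_def)
  have s1: "?D s1" "arr s1 ''x'' 0 = -1" "reg s1 ''c'' = c" "arr s1 ''out'' = arr s ''out''"
    using D0 fr0 c by (auto simp: s1_def frame_def)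
  have "runs (displacement_prog (scalar ''x'') ;; ?base ;; ?loop) s1
      ((n * 2 + 1) + (1 + (M + 1) * ((n * 2 + 1) + 1))) (\<lambda>s'. ?Q (M + 1) (arr s'))"
  proof (rule runs_Seq[OF runs_displacement_prog[OF prepD(1)[OF pre1] _ _ s1(1)]])
    fix s2
    assume h2: "arr s2 ''h'' 0 = ?dis (arr s1 ''x'' (ival (INat 0) s1))"
      and fr2: "frame (displacement_prog (scalar ''x'')) s1 s2"
    have "prepared n d M \<tau> W t s2"
      by (rule prepared_frame[OF pre1 fr2]) auto
    then have "\<forall>i\<le>n. \<forall>c<d. arr s2 ''W'' (i * d + c) = W i c"
      by (simp add: prepared_def has_input_def)
    with c have W0: "arr s2 ''W'' c = W 0 c"
      by (metis add_0 le0 mult_0)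
    define s3 where "s3 = store (scalar ''base'') (W 0 c - ?dis (-1)) s2"
    have pre3: "prepared n d M \<tau> W t s3"
      using \<open>prepared n d M \<tau> W t s2\<close> by (simp add: prepared_def has_input_def s3_def)
    have s3: "?D s3" "reg s3 ''c'' = c" "arr s3 ''base'' 0 = W 0 c - ?dis (-1)"
        "arr s3 ''out'' = arr s ''out''"
      using fr2 s1 by (auto simp: s3_def frame_def)
    have "runs ?loop s3 ((M + 1) * ((n * 2 + 1) + 1)) (\<lambda>s'. ?Q (M + 1) (arr s'))"
    proof (rule runs_For[where Inv = ?Q])
      fix m s4
      assume m: "m < M + 1" "reg s4 ''j'' = m" and fr4: "frame ?loop s3 s4" and inv: "?Q m (arr s4)"
      have pre4: "prepared n d M \<tau> W t s4"
        by (rule prepared_frame[OF pre3 fr4]) auto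
      have D4: "?D s4" and b4: "arr s4 ''base'' 0 = W 0 c - ?dis (-1)" and c4: "reg s4 ''c'' = c"
        using fr4 s3 by (simp_all add: frame_def)
      show "runs ?body s4 ((n * 2 + 1) + 1) (\<lambda>s'. ?Q (Suc m) (arr s'))"
      proof (rule runs_Seq[OF runs_displacement_prog[OF prepD(1)[OF pre4] _ _ D4]])
        fix s5
        assume h5: "arr s5 ''h'' 0 = ?dis (arr s4 ''t'' (ival (IReg ''j'') s4))"
          and fr5: "frame (displacement_prog (Cell ''t'' (IReg ''j''))) s4 s5"
        have s5: "reg s5 ''j'' = m" "reg s5 ''d'' = d" "reg s5 ''c'' = c"
            "arr s5 ''base'' 0 = W 0 c - ?dis (-1)" "arr s5 ''out'' = arr s4 ''out''"
          using fr5 m c4 b4 prepD[OF pre4] by (simp_all add: frame_def)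
        have "arr s4 ''t'' m = t m"
          using prepD(4)[OF pre4] m by simp
        then have "arr s5 ''h'' 0 + arr s5 ''base'' 0 = GL_curve n \<tau> W (t m) c"
          using GL_curve_eq[OF n, of "t m" \<tau> W c] h5 s5 m t by simp
        then show "runs (Arith RAdd (Cell ''out'' (IAdd (IMul (IReg ''j'') (IReg ''d'')) (IReg ''c'')))
          (scalar ''h'') (scalar ''base'')) s5 1 (\<lambda>s'. ?Q (Suc m) (arr s'))"
          by (intro runs_Arith) (use s5 inv c in \<open>auto simp: row_major_inj less_Suc_eq\<close>)
      qed simp_all
    qed (use prepD(3)[OF pre3] s3 in auto)
    moreover have "arr s2 ''h'' 0 = ?dis (-1)" "reg s2 ''c'' = c"
      using h2 s1 fr2 by (simp_all add: frame_def)
    ultimately show "runs (?base ;; ?loop) s2 (1 + (M + 1) * ((n * 2 + 1) + 1)) (\<lambda>s'. ?Q (M + 1) (arr s'))"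
      by (intro runs_Seq_Arith) (use W0 in \<open>simp_all add: s3_def\<close>)
  qed simp_all
  then show "runs (displacement_prog (scalar ''x'') ;; ?base ;; ?loop)
      (store (scalar ''x'') (of_int (-1)) s0)
      ((n * 2 + 1) + (1 + (M + 1) * ((n * 2 + 1) + 1)))
      (\<lambda>s'. \<forall>j\<le>M. \<forall>c'<d. arr s' ''out'' (j * d + c') =
        (if c' = c then GL_curve n \<tau> W (t j) c else arr s ''out'' (j * d + c')))"
    unfolding s1_def[symmetric] by (rule runs_mono) auto
qed

section \<open>The algorithm and its cost\<close>

definition curve_prog :: prog where
  "curve_prog =
     integers_prog ;;
     legendre_prog ''P'' (IReg ''n'') ;;
     legendre_prog ''R'' (ISub (IReg ''n'') (INat 1)) ;;
     For ''c'' (IReg ''d'') coordinate_prog"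

definition legendre_cost :: "nat \<Rightarrow> nat" where
  "legendre_cost l = 0 + (l * ((2 * l + 1) * 2) + l * (2 * l * 1))"

definition curve_cost :: "nat \<Rightarrow> nat \<Rightarrow> nat \<Rightarrow> nat" where
  "curve_cost n d M = (2 * n + 1) * 1 +
     (legendre_cost n + (legendre_cost (n - 1) + d * coordinate_cost n M))"

lemma runs_curve_prog:
  assumes inp: "has_input s n d M \<tau> W t" and n: "n \<ge> 1" and t: "\<forall>j\<le>M. -1 \<le> t j"
  shows "runs curve_prog s (curve_cost n d M) (\<lambda>s'. has_output s' d M (\<lambda>j. GL_curve n \<tau> W (t j)))"
  unfolding curve_prog_def curve_cost_def
proof (rule runs_Seq[OF runs_integers])
  show "reg s ''n'' = n"
    using inp by (simp add: has_input_def)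
  let ?P = "legendre_prog ''P'' (IReg ''n'')"
  let ?R = "legendre_prog ''R'' (ISub (IReg ''n'') (INat 1))"
  let ?loop = "For ''c'' (IReg ''d'') coordinate_prog"
  fix s1
  assume num: "\<forall>k\<le>2 * n + 1. arr s1 ''num'' k = real k" and fr1: "frame integers_prog s s1"
  have inp1: "has_input s1 n d M \<tau> W t"
    using inp fr1 by (simp add: has_input_def frame_def)
  show "runs (?P ;; ?R ;; ?loop) s1
      (legendre_cost n + (legendre_cost (n - 1) + d * coordinate_cost n M))
      (\<lambda>s'. has_output s' d M (\<lambda>j. GL_curve n \<tau> W (t j)))"
    unfolding legendre_cost_def
  proof (rule runs_Seq[OF runs_legendre_prog])
    fix s2
    assume P: "\<forall>k\<le>n. arr s2 ''P'' k = coeff (legendre n) k" and fr2: "frame ?P s1 s2"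
    have inp2: "has_input s2 n d M \<tau> W t"
      using inp1 fr2 by (simp add: has_input_def frame_def)
    have num2: "\<forall>k\<le>2 * n + 1. arr s2 ''num'' k = real k"
      using num fr2 by (simp add: frame_def)
    show "runs (?R ;; ?loop) s2
      (0 + ((n - 1) * ((2 * (n - 1) + 1) * 2) + (n - 1) * (2 * (n - 1) * 1)) + d * coordinate_cost n M)
      (\<lambda>s'. has_output s' d M (\<lambda>j. GL_curve n \<tau> W (t j)))"
    proof (rule runs_Seq[OF runs_legendre_prog])
      fix s3
      assume R: "\<forall>k\<le>n - 1. arr s3 ''R'' k = coeff (legendre (n - 1)) k" and fr3: "frame ?R s2 s3"
      have pre3: "prepared n d M \<tau> W t s3"
        using inp2 num2 P R fr3 by (simp add: prepared_def has_input_def frame_def)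
      let ?Q = "\<lambda>c A. \<forall>j\<le>M. \<forall>c'<c. A ''out'' (j * d + c') = GL_curve n \<tau> W (t j) c'"
      have "runs ?loop s3 (d * coordinate_cost n M) (\<lambda>s'. ?Q d (arr s'))"
      proof (rule runs_For[where Inv = ?Q])
        fix c s4
        assume c: "c < d" "reg s4 ''c'' = c" and fr4: "frame ?loop s3 s4" and inv: "?Q c (arr s4)"
        have "prepared n d M \<tau> W t s4"
          by (rule prepared_frame[OF pre3 fr4]) auto
        from runs_coordinate_prog[OF this n c(2,1) t]
        show "runs coordinate_prog s4 (coordinate_cost n M) (\<lambda>s'. ?Q (Suc c) (arr s'))"
          by (rule runs_mono) (use inv c in auto)
      qed (use pre3 in \<open>auto simp: prepared_def has_input_def\<close>)
      then show "runs ?loop s3 (d * coordinate_cost n M)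
          (\<lambda>s'. has_output s' d M (\<lambda>j. GL_curve n \<tau> W (t j)))"
        by (rule runs_mono) (auto simp: has_output_def)
    qed (use inp2 num2 in \<open>auto simp: has_input_def\<close>)
  qed (use inp1 num in \<open>auto simp: has_input_def\<close>)
qed

lemma curve_cost_le:
  assumes "n \<ge> 1" "d \<ge> 1"
  shows "curve_cost n d M \<le> 40 * (M * d * n + d * n ^ 2)"
proof -
  \<comment> \<open>After this substitution both sides are polynomials in \<open>n'\<close>, \<open>d'\<close>, \<open>M\<close> with nonnegative
    coefficients, and the inequality holds coefficient by coefficient.\<close>
  obtain n' d' where "n = Suc n'" "d = Suc d'"
    using assms by (metis Suc_le_D One_nat_def)
  then show ?thesis
    by (simp add: curve_cost_def legendre_cost_def coordinate_cost_def algebra_simps power2_eq_square)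
qed

theorem mainTheorem7:
  shows "\<exists>(p :: prog) (C :: nat).
    \<forall>(n :: nat) (d :: nat) (M :: nat) (\<tau> :: nat \<Rightarrow> real) (W :: nat \<Rightarrow> point)
      (t :: nat \<Rightarrow> real) (s :: ram).
      n \<ge> 1 \<longrightarrow> d \<ge> 1 \<longrightarrow> legendre_zeros n \<tau> \<longrightarrow>
      (\<forall>j\<le>M. -1 \<le> t j \<and> t j \<le> 1) \<longrightarrow> strict_mono_on {0..M} t \<longrightarrow>
      has_input s n d M \<tau> W t \<longrightarrow>
      (\<exists>k s'. exec p s k s' \<and>
              has_output s' d M (\<lambda>j. GL_curve n \<tau> W (t j)) \<and>
              k \<le> C * (M * d * n + d * n ^ 2))"
proof (rule exI[of _ curve_prog], rule exI[of _ 40], intro allI impI)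
  fix n d M :: nat and \<tau> :: "nat \<Rightarrow> real" and W :: "nat \<Rightarrow> point" and t :: "nat \<Rightarrow> real" and s :: ram
  assume "n \<ge> 1" "d \<ge> 1" and t: "\<forall>j\<le>M. -1 \<le> t j \<and> t j \<le> 1" and "has_input s n d M \<tau> W t"
  then have "runs curve_prog s (curve_cost n d M) (\<lambda>s'. has_output s' d M (\<lambda>j. GL_curve n \<tau> W (t j)))"
    by (intro runs_curve_prog) auto
  moreover have "curve_cost n d M \<le> 40 * (M * d * n + d * n ^ 2)"
    by (rule curve_cost_le) fact+
  ultimately show "\<exists>k s'. exec curve_prog s k s' \<and> has_output s' d M (\<lambda>j. GL_curve n \<tau> W (t j)) \<and>
      k \<le> 40 * (M * d * n + d * n ^ 2)"
    unfolding runs_def by (meson order_trans)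
qed

end
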